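(* For any $0<\gamma<1$, there exists a sequence $(x_n)_{n\in\mathbb{N}}\subseteq[0,1]$ with an absolutely continuous asymptotic distribution function $G$ and corresponding asymptotic density function $g:[0,1]\to\mathbb{R}$ such that $$\limsup_{s\to\infty}\frac{F_\gamma(s)}{2s}<\int_0^1 g(x)g(x+\gamma)\,\mathrm{d}x,$$ where $$F_\gamma(s)=\liminf_{N\to\infty}\frac{1}{N}\#\Big\{1\leqslant m\neq n\leqslant N:\ \|x_m-x_n-\gamma\|\leqslant\frac{s}{N}\Big\},\qquad s>0.$$
   Context: For $x\in\mathbb{R}$, $\|x\|=\min\{|x-k|:k\in\mathbb{Z}\}$. A function $G:[0,1]\to\mathbb{R}$ is the asymptotic distribution function of $(x_n)_{n\in\mathbb{N}}$ if $G(x)=\lim_{N\to\infty}\frac1N\#\{n\leqslant N:0\leqslant x_n\leqslant x\}$ for all $0\leqslant x\leqslant1$; if $G$ is absolutely continuous, its asymptotic density function is $g$ with $g=G'$ almost everywhere. In the integral, $g$ is extended to $\mathbb{R}$ periodically with period $1$. *)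

theory Defs
  imports "HOL-Analysis.Analysis"
begin

definition dist_int :: "real \<Rightarrow> real" where
  "dist_int x = (INF k::int. \<bar>x - of_int k\<bar>)"

text \<open>The infimum is attained, so it is the minimum.\<close>

lemma dist_int_attained: "\<exists>k::int. dist_int x = \<bar>x - of_int k\<bar>"
proof -
  have le: "\<bar>x - of_int (round x)\<bar> \<le> \<bar>x - of_int k\<bar>" for k :: int
    using round_diff_minimal[of x k] .
  have "dist_int x = \<bar>x - of_int (round x)\<bar>"
    unfolding dist_int_def by (rule cInf_eq_minimum) (use le in auto)
  then show ?thesis by blast
qed

lemma dist_int_le: "dist_int x \<le> \<bar>x - of_int k\<bar>"
  unfolding dist_int_def by (rule cINF_lower) (auto intro: bdd_belowI[of _ 0])

text \<open>Absolute continuity on an interval \<open>S\<close>. The family of non-overlapping subintervals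
  \<open>[a i, b i]\<close> is indexed by \<open>i < n\<close>; degenerate intervals are permitted and contribute nothing.\<close>

definition abs_cont_on :: "real set \<Rightarrow> (real \<Rightarrow> real) \<Rightarrow> bool" where
  "abs_cont_on S f \<longleftrightarrow>
    (\<forall>\<epsilon>>0. \<exists>\<delta>>0. \<forall>(n::nat) (a::nat \<Rightarrow> real) (b::nat \<Rightarrow> real).
      (\<forall>i<n. a i \<le> b i \<and> {a i..b i} \<subseteq> S) \<and>
      disjoint_family_on (\<lambda>i. {a i<..<b i}) {..<n} \<and>
      (\<Sum>i<n. b i - a i) < \<delta> \<longrightarrow>
      (\<Sum>i<n. \<bar>f (b i) - f (a i)\<bar>) < \<epsilon>)"

text \<open>Sequences are indexed by the positive integers: the value \<open>x 0\<close> is never used below.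
  Functions on \<open>[0, 1]\<close> are total functions whose values outside \<open>[0, 1]\<close> are never used.\<close>

definition asymptotic_distribution :: "(nat \<Rightarrow> real) \<Rightarrow> (real \<Rightarrow> real) \<Rightarrow> bool" where
  "asymptotic_distribution x G \<longleftrightarrow>
    (\<forall>t\<in>{0..1}. (\<lambda>N::nat. real (card {n\<in>{1..N}. 0 \<le> x n \<and> x n \<le> t}) / real N) \<longlonglongrightarrow> G t)"

definition ae_derivative :: "(real \<Rightarrow> real) \<Rightarrow> (real \<Rightarrow> real) \<Rightarrow> bool" where
  "ae_derivative G g \<longleftrightarrow>
    (AE t in lebesgue. t \<in> {0..1} \<longrightarrow> (G has_real_derivative g t) (at t within {0..1}))"

text \<open>The extension of a function on \<open>[0, 1]\<close> with period 1; at integers the value at 0 is taken.\<close>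

definition periodic_ext :: "(real \<Rightarrow> real) \<Rightarrow> real \<Rightarrow> real" where
  "periodic_ext g t = g (frac t)"

text \<open>The lower limit may be infinite for some sequences, hence the extended reals.\<close>

definition pair_count_liminf :: "(nat \<Rightarrow> real) \<Rightarrow> real \<Rightarrow> real \<Rightarrow> ereal" where
  "pair_count_liminf x \<gamma> s =
    liminf (\<lambda>N::nat. ereal (real (card {(m, n). m \<in> {1..N} \<and> n \<in> {1..N} \<and> m \<noteq> n \<and>
        dist_int (x m - x n - \<gamma>) \<le> s / real N}) / real N))"

end

theory Submission
  imports Defs "HOL-Library.Discrete_Functions" "HOL-Real_Asymp.Real_Asymp"
begin

text \<open>
  Choose \<open>r \<in> {2, 3}\<close> such that \<open>\<gamma>\<close> lies in none of the lattices \<open>r\<^sup>-\<^sup>k \<int>\<close>, and let \<open>d k > 0\<close> be a lower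
  bound for the distance from \<open>\<gamma>\<close> to \<open>r\<^sup>-\<^sup>k \<int>\<close>. Round an equidistributed sequence down to these
  nested lattices, taking \<open>k = \<kappa> n\<close> for the \<open>n\<close>-th term. As \<open>\<kappa> n \<rightarrow> \<infinity>\<close>, the sequence stays
  equidistributed, so \<open>G t = t\<close>, \<open>g = 1\<close>, and the integral is 1. All differences
  \<open>x m - x n\<close> with \<open>m, n \<le> N\<close> lie in \<open>r\<^sup>-\<^sup>\<kappa>\<^sup>N \<int>\<close>, hence stay \<open>d (\<kappa> N)\<close> away from \<open>\<gamma>\<close> modulo 1. If
  \<open>\<kappa>\<close> grows so slowly that \<open>\<kappa> N \<le> N d (\<kappa> N)\<close>, this exceeds \<open>s / N\<close> for all large \<open>N\<close>: there are
  eventually no pairs at all and the pair count vanishes for every \<open>s\<close>.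
\<close>

section \<open>An equidistributed sequence with explicit discrepancy\<close>

text \<open>The block of indices from \<open>M\<^sup>2\<close> to \<open>(M + 1)\<^sup>2 - 1\<close> runs through the multiples of \<open>1 / (2 M + 1)\<close>
  in \<open>[0, 1)\<close>.\<close>

definition sqrt_blocks :: "nat \<Rightarrow> real" where
  "sqrt_blocks n = real (n - (floor_sqrt n)\<^sup>2) / real (2 * floor_sqrt n + 1)"

lemma floor_sqrt_block:
  assumes "j \<le> 2 * M"
  shows "floor_sqrt (M\<^sup>2 + j) = M"
  by (rule floor_sqrt_unique) (use assms in \<open>auto simp: power2_eq_square\<close>)

lemma sqrt_blocks_block:
  assumes "j \<le> 2 * M"
  shows "sqrt_blocks (M\<^sup>2 + j) = real j / real (2 * M + 1)"
  by (simp add: sqrt_blocks_def floor_sqrt_block[OF assms])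

lemma sqrt_blocks_bounds: "0 \<le> sqrt_blocks n" "sqrt_blocks n < 1"
proof -
  have "n - (floor_sqrt n)\<^sup>2 < 2 * floor_sqrt n + 1"
    using Suc_floor_sqrt_power2_gt[of n] by (simp add: power2_eq_square)
  then have "real (n - (floor_sqrt n)\<^sup>2) < real (2 * floor_sqrt n + 1)"
    by (rule of_nat_less_iff[THEN iffD2])
  then show "sqrt_blocks n < 1" unfolding sqrt_blocks_def by simp
qed (simp add: sqrt_blocks_def)

text \<open>The set is an initial segment of the naturals: it contains every \<open>j\<close> below
  the ceiling of \<open>t * L\<close>, where \<open>t \<le> 1\<close> forces \<open>j < L\<close>,
  and no \<open>j\<close> above the floor. With \<open>L = 2 * M + 1\<close> it counts the hits in
  one block.\<close>

lemma card_le_mult_bounds: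
  fixes t :: real
  assumes "0 \<le> t" "t \<le> 1"
  shows "t * real L \<le> real (card {j. j < L \<and> real j \<le> t * real L})"
    and "real (card {j. j < L \<and> real j \<le> t * real L}) \<le> t * real L + 1"
proof -
  let ?C = "{j. j < L \<and> real j \<le> t * real L}"
  have tL: "0 \<le> t * real L" "t * real L \<le> real L"
    using assms by (auto simp: mult_left_le_one_le)
  have "{..<nat \<lceil>t * real L\<rceil>} \<subseteq> ?C"
  proof
    fix j assume "j \<in> {..<nat \<lceil>t * real L\<rceil>}"
    then have "real j < t * real L" by (simp add: zless_nat_eq_int_zless less_ceiling_iff)
    with tL show "j \<in> ?C" by simp
  qed
  then have "nat \<lceil>t * real L\<rceil> \<le> card ?C"
    using card_mono[of ?C "{..<nat \<lceil>t * real L\<rceil>}"] by simp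
  then show "t * real L \<le> real (card ?C)" by linarith
  have "?C \<subseteq> {..nat \<lfloor>t * real L\<rfloor>}"
    using tL by (auto simp: le_nat_iff le_floor_iff)
  then have "card ?C \<le> Suc (nat \<lfloor>t * real L\<rfloor>)"
    using card_mono[of "{..nat \<lfloor>t * real L\<rfloor>}" ?C] by simp
  then show "real (card ?C) \<le> t * real L + 1" using tL by linarith
qed

text \<open>Induction over complete blocks: each block overshoots its share
  \<open>t * (2 * M + 1)\<close> by at most 1 and never undershoots it, so \<open>M\<close> blocks
  give an error of at most \<open>M\<close>.\<close>

lemma card_sqrt_blocks_square:
  fixes t :: real
  assumes "0 \<le> t" "t \<le> 1"
  shows "t * real (M\<^sup>2) \<le> real (card {n. n < M\<^sup>2 \<and> sqrt_blocks n \<le> t}) \<and>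
    real (card {n. n < M\<^sup>2 \<and> sqrt_blocks n \<le> t}) \<le> t * real (M\<^sup>2) + real M"
proof (induction M)
  case 0
  then show ?case by simp
next
  case (Suc M)
  let ?A = "\<lambda>N. {n. n < N \<and> sqrt_blocks n \<le> t}"
  let ?L = "2 * M + 1"
  let ?C = "{j. j < ?L \<and> real j \<le> t * real ?L}"
  have sq: "(Suc M)\<^sup>2 = M\<^sup>2 + ?L" by (simp add: power2_eq_square)
  have in_block: "sqrt_blocks (M\<^sup>2 + j) \<le> t \<longleftrightarrow> real j \<le> t * real ?L" if "j < ?L" for j
    using that by (simp add: sqrt_blocks_block pos_divide_le_eq del: of_nat_mult of_nat_add)
  have "?A ((Suc M)\<^sup>2) = ?A (M\<^sup>2) \<union> (\<lambda>j. M\<^sup>2 + j) ` ?C"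
  proof (intro set_eqI iffI)
    fix n assume n: "n \<in> ?A ((Suc M)\<^sup>2)"
    show "n \<in> ?A (M\<^sup>2) \<union> (\<lambda>j. M\<^sup>2 + j) ` ?C"
    proof (cases "n < M\<^sup>2")
      case False
      then have "n = M\<^sup>2 + (n - M\<^sup>2)" "n - M\<^sup>2 < ?L" using n sq by auto
      moreover from this have "n - M\<^sup>2 \<in> ?C"
        using n in_block[of "n - M\<^sup>2"] by simp
      ultimately show ?thesis by blast
    qed (use n in auto)
  next
    fix n assume "n \<in> ?A (M\<^sup>2) \<union> (\<lambda>j. M\<^sup>2 + j) ` ?C"
    then show "n \<in> ?A ((Suc M)\<^sup>2)" using in_block sq by auto
  qed
  moreover have "?A (M\<^sup>2) \<inter> (\<lambda>j. M\<^sup>2 + j) ` ?C = {}" by auto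
  ultimately have "card (?A ((Suc M)\<^sup>2)) = card (?A (M\<^sup>2)) + card ?C"
    by (simp add: card_Un_disjoint card_image)
  moreover have "t * real ((Suc M)\<^sup>2) = t * real (M\<^sup>2) + t * real ?L"
    unfolding sq by (simp add: algebra_simps)
  ultimately show ?case
    using Suc card_le_mult_bounds[OF assms, of ?L] by simp
qed

text \<open>\<open>N\<close> lies between consecutive squares. Replacing \<open>N\<close> by one of
  them costs at most \<open>2 * M + 1\<close>, the complete blocks cost at most
  \<open>M + 1\<close>, and \<open>M \<le> sqrt N\<close>.\<close>

lemma card_sqrt_blocks_error:
  fixes t :: real
  assumes "0 \<le> t" "t \<le> 1"
  shows "\<bar>real (card {n. n < N \<and> sqrt_blocks n \<le> t}) - t * real N\<bar> \<le> 3 * sqrt (real N) + 2"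
proof -
  let ?A = "\<lambda>N. {n. n < N \<and> sqrt_blocks n \<le> t}"
  define M where "M = floor_sqrt N"
  have N: "M\<^sup>2 \<le> N" "N < (Suc M)\<^sup>2"
    using Suc_floor_sqrt_power2_gt[of N] by (auto simp: M_def)
  have sq: "real ((Suc M)\<^sup>2) = real (M\<^sup>2) + (2 * real M + 1)"
    by (simp add: power2_eq_square algebra_simps)
  have mono: "card (?A K) \<le> card (?A K')" if "K \<le> K'" for K K'
    using that by (intro card_mono) auto
  have "t * real (M\<^sup>2) \<le> real (card (?A N))"
    using card_sqrt_blocks_square[OF assms, of M] mono[OF N(1)] by linarith
  moreover have "real (card (?A N)) \<le> t * real ((Suc M)\<^sup>2) + real (Suc M)"
    using card_sqrt_blocks_square[OF assms, of "Suc M"] mono[of N "(Suc M)\<^sup>2"] N(2) by linarith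
  moreover have "t * real ((Suc M)\<^sup>2) = t * real (M\<^sup>2) + t * (2 * real M + 1)"
    unfolding sq by (simp add: algebra_simps)
  moreover have "t * (2 * real M + 1) \<le> 2 * real M + 1"
    using assms by (intro mult_left_le_one_le) auto
  moreover have "t * real (M\<^sup>2) \<le> t * real N" "t * real N \<le> t * real ((Suc M)\<^sup>2)"
    using N assms by (intro mult_left_mono; simp del: of_nat_power)+
  moreover have "real M \<le> sqrt (real N)"
    using N(1) by (intro real_le_rsqrt) (simp flip: of_nat_power)
  ultimately show ?thesis by linarith
qed

lemma sqrt_blocks_equidistributed:
  fixes t :: real
  assumes "0 \<le> t" "t \<le> 1"
  shows "(\<lambda>N. real (card {n\<in>{1..N}. sqrt_blocks n \<le> t}) / real N) \<longlonglongrightarrow> t"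
proof -
  let ?c = "\<lambda>N. real (card {n\<in>{1..N}. sqrt_blocks n \<le> t})"
  have err: "\<bar>?c N - t * real N\<bar> \<le> 3 * sqrt (real N + 1) + 4" for N
  proof -
    \<comment> \<open>Index 0 always counts because \<open>sqrt_blocks 0 = 0\<close>; dropping it
      changes the error by \<open>1 - t\<close>, hence by at most 1.\<close>
    have "{n. n < Suc N \<and> sqrt_blocks n \<le> t} = insert 0 {n\<in>{1..N}. sqrt_blocks n \<le> t}"
      using assms by (auto simp: sqrt_blocks_def)
    then have "card {n. n < Suc N \<and> sqrt_blocks n \<le> t} = Suc (card {n\<in>{1..N}. sqrt_blocks n \<le> t})"
      by simp
    moreover have "t * real (Suc N) = t * real N + t" by (simp add: algebra_simps)
    moreover have "real (Suc N) = real N + 1" by simp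
    ultimately show ?thesis
      using card_sqrt_blocks_error[OF assms, of "Suc N"] assms by (simp only: abs_le_iff) linarith
  qed
  have "(\<lambda>N. ?c N / real N - t) \<longlonglongrightarrow> 0"
  proof (rule Lim_null_comparison)
    show "(\<lambda>N. (3 * sqrt (real N + 1) + 4) / real N) \<longlonglongrightarrow> 0" by real_asymp
    have "norm (?c N / real N - t) \<le> (3 * sqrt (real N + 1) + 4) / real N" if "N > 0" for N
    proof -
      have "?c N / real N - t = (?c N - t * real N) / real N"
        using that by (simp add: field_simps)
      with err[of N] show ?thesis by (simp add: abs_divide divide_right_mono)
    qed
    then show "\<forall>\<^sub>F N in sequentially. norm (?c N / real N - t) \<le> (3 * sqrt (real N + 1) + 4) / real N"
      by (intro eventually_sequentiallyI[of 1]) simp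
  qed
  then show ?thesis by (simp add: LIM_zero_iff)
qed

section \<open>Stability of uniform distribution under vanishing downward shifts\<close>

lemma asymptotic_distribution_perturb:
  fixes x y :: "nat \<Rightarrow> real"
  assumes y: "\<And>t. 0 \<le> t \<Longrightarrow> t \<le> 1 \<Longrightarrow>
      (\<lambda>N. real (card {n\<in>{1..N}. y n \<le> t}) / real N) \<longlonglongrightarrow> t"
    and x0: "\<And>n. 0 \<le> x n" and xy: "\<And>n. x n \<le> y n"
    and lim: "(\<lambda>n. y n - x n) \<longlonglongrightarrow> 0"
  shows "asymptotic_distribution x (\<lambda>t. t)"
  unfolding asymptotic_distribution_def
proof
  fix t :: real assume t: "t \<in> {0..1}"
  let ?cx = "\<lambda>N. real (card {n\<in>{1..N}. 0 \<le> x n \<and> x n \<le> t})"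
  let ?cy = "\<lambda>u N. real (card {n\<in>{1..N}. y n \<le> u})"
  have lower: "?cy t N / real N \<le> ?cx N / real N" for N
  proof -
    have "{n\<in>{1..N}. y n \<le> t} \<subseteq> {n\<in>{1..N}. 0 \<le> x n \<and> x n \<le> t}"
      using x0 xy order_trans by blast
    then show ?thesis by (intro divide_right_mono of_nat_mono card_mono) auto
  qed
  show "(\<lambda>N. ?cx N / real N) \<longlonglongrightarrow> t"
  proof (rule order_tendstoI)
    fix a assume "a < t"
    with y[of t] t have "\<forall>\<^sub>F N in sequentially. a < ?cy t N / real N"
      by (auto intro: order_tendstoD)
    then show "\<forall>\<^sub>F N in sequentially. a < ?cx N / real N"
      by eventually_elim (use lower less_le_trans in blast)
  next
    fix a assume a: "t < a"
    show "\<forall>\<^sub>F N in sequentially. ?cx N / real N < a"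
    \<comment> \<open>The comparison level \<open>u\<close> must lie in \<open>(t, 1]\<close>, which
      is impossible for \<open>t = 1\<close>; there the trivial bound 1 suffices.\<close>
    proof (cases "t = 1")
      case True
      have "?cx N / real N \<le> 1" for N
      proof -
        have "card {n\<in>{1..N}. 0 \<le> x n \<and> x n \<le> t} \<le> card {1..N}"
          by (intro card_mono) auto
        then show ?thesis by (cases "N = 0") (auto simp: divide_le_eq_1)
      qed
      with a True show ?thesis by (intro always_eventually) (auto intro: le_less_trans)
    next
      case False
      obtain u where u: "t < u" "u < a" "u \<le> 1"
        using dense[of t "min a 1"] False t a by force
      \<comment> \<open>From \<open>n0\<close> on, \<open>x n \<le> t\<close> forces
        \<open>y n \<le> u\<close>; the earlier indices add at most \<open>n0\<close>, which is
        negligible after division by \<open>N\<close>.\<close>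
      have "\<forall>\<^sub>F n in sequentially. y n - x n < u - t"
        using order_tendstoD(2)[OF lim] u by simp
      then obtain n0 where n0: "y n - x n < u - t" if "n \<ge> n0" for n
        by (auto simp: eventually_sequentially)
      have upper: "?cx N / real N \<le> ?cy u N / real N + real n0 / real N" for N
      proof -
        have "{n\<in>{1..N}. 0 \<le> x n \<and> x n \<le> t} \<subseteq> {n\<in>{1..N}. y n \<le> u} \<union> {..<n0}"
        proof
          fix n assume "n \<in> {n\<in>{1..N}. 0 \<le> x n \<and> x n \<le> t}"
          then show "n \<in> {n\<in>{1..N}. y n \<le> u} \<union> {..<n0}"
            using n0[of n] by (cases "n < n0") auto
        qed
        then have "card {n\<in>{1..N}. 0 \<le> x n \<and> x n \<le> t} \<le> card ({n\<in>{1..N}. y n \<le> u} \<union> {..<n0})"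
          by (intro card_mono) auto
        also have "\<dots> \<le> card {n\<in>{1..N}. y n \<le> u} + n0"
          using card_Un_le[of _ "{..<n0}"] by simp
        finally have "?cx N \<le> ?cy u N + real n0" by linarith
        then show ?thesis by (simp add: divide_right_mono flip: add_divide_distrib)
      qed
      have "(\<lambda>N. real n0 / real N) \<longlonglongrightarrow> 0" by real_asymp
      then have "(\<lambda>N. ?cy u N / real N + real n0 / real N) \<longlonglongrightarrow> u + 0"
        using t u by (intro tendsto_add y) auto
      with u have "\<forall>\<^sub>F N in sequentially. ?cy u N / real N + real n0 / real N < a"
        by (intro order_tendstoD(2)) auto
      then show ?thesis by eventually_elim (use upper le_less_trans in blast)
    qed
  qed
qed

section \<open>Choice of the base and of the lattice exponents\<close>

text \<open>One of the bases 2 and 3 works: by Bezout, \<open>\<gamma>\<close> is an integer combination of \<open>2\<^sup>a \<gamma>\<close>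
  and \<open>3\<^sup>b \<gamma>\<close>.\<close>

lemma base_avoiding_integers:
  fixes \<gamma> :: real
  assumes "\<gamma> \<notin> \<int>"
  obtains r :: nat where "r \<ge> 2" "\<And>k. real r ^ k * \<gamma> \<notin> \<int>"
proof (cases "\<forall>k. 2 ^ k * \<gamma> \<notin> \<int>")
  case True
  then show ?thesis using that[of 2] by simp
next
  case False
  then obtain a where a: "2 ^ a * \<gamma> \<in> \<int>" by blast
  have "3 ^ b * \<gamma> \<notin> \<int>" for b
  proof
    assume b: "3 ^ b * \<gamma> \<in> \<int>"
    have "gcd (2 ^ a :: int) (3 ^ b) = 1" by (simp flip: coprime_iff_gcd_eq_1)
    then obtain u v :: int where uv: "u * 2 ^ a + v * 3 ^ b = 1"
      using bezout_int[of "2 ^ a" "3 ^ b"] by auto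
    have "of_int u * (2 ^ a * \<gamma>) + of_int v * (3 ^ b * \<gamma>) = of_int (u * 2 ^ a + v * 3 ^ b) * \<gamma>"
      by (simp add: distrib_right)
    also have "\<dots> = \<gamma>" by (simp only: uv of_int_1 mult_1)
    finally have "of_int u * (2 ^ a * \<gamma>) + of_int v * (3 ^ b * \<gamma>) = \<gamma>" .
    moreover have "of_int u * (2 ^ a * \<gamma>) + of_int v * (3 ^ b * \<gamma>) \<in> \<int>"
      by (intro Ints_add Ints_mult Ints_of_int a b)
    ultimately have "\<gamma> \<in> \<int>" by simp
    with assms show False by simp
  qed
  then show ?thesis using that[of 3] by simp
qed

lemma dist_int_pos:
  assumes "x \<notin> \<int>"
  shows "0 < dist_int x"
proof -
  obtain k :: int where "dist_int x = \<bar>x - of_int k\<bar>" using dist_int_attained by blast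
  with assms show ?thesis by auto
qed

lemma slow_unbounded_exponent:
  fixes d :: "nat \<Rightarrow> real"
  assumes "\<And>k. d k > 0"
  obtains \<kappa> :: "nat \<Rightarrow> nat" where "mono \<kappa>" "filterlim \<kappa> at_top sequentially"
    "\<And>n. real (\<kappa> n) \<le> real n * d (\<kappa> n)"
proof -
  \<comment> \<open>Take the largest admissible exponent. The cut-off \<open>k \<le> n\<close> makes
    the maximum exist, 0 is always admissible, and the sets grow with \<open>n\<close>, so
    \<open>\<kappa>\<close> is monotone.\<close>
  define S where "S n = {k. k \<le> n \<and> real k \<le> real n * d k}" for n
  define \<kappa> where "\<kappa> n = Max (S n)" for n
  have fin: "finite (S n)" for n by (simp add: S_def)
  have ne: "0 \<in> S n" for n using assms[of 0] by (simp add: S_def less_imp_le)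
  have sub: "S m \<subseteq> S n" if "m \<le> n" for m n
  proof
    fix k assume k: "k \<in> S m"
    have "real m * d k \<le> real n * d k"
      using that assms[of k] by (intro mult_right_mono) auto
    with k that show "k \<in> S n" by (auto simp: S_def)
  qed
  show ?thesis
  proof
    show "mono \<kappa>"
      unfolding \<kappa>_def by (intro monoI Max_mono sub fin) (use ne in auto)
    show "real (\<kappa> n) \<le> real n * d (\<kappa> n)" for n
    proof -
      have "\<kappa> n \<in> S n" unfolding \<kappa>_def by (intro Max_in fin) (use ne in auto)
      then show ?thesis by (simp add: S_def)
    qed
    show "filterlim \<kappa> at_top sequentially"
      unfolding filterlim_at_top
    proof
      fix k
      \<comment> \<open>As \<open>d k > 0\<close>, every fixed \<open>k\<close> is admissible from
        some \<open>n\<close> on.\<close>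
      have "k \<le> \<kappa> n" if n: "n \<ge> max k (nat \<lceil>real k / d k\<rceil>)" for n
      proof -
        have "real k / d k \<le> real n" using n by linarith
        then have "k \<in> S n" using n assms[of k] by (simp add: S_def pos_divide_le_eq)
        then show ?thesis unfolding \<kappa>_def using fin by (intro Max_ge)
      qed
      then show "\<forall>\<^sub>F n in sequentially. k \<le> \<kappa> n" by (rule eventually_sequentiallyI)
    qed
  qed
qed

section \<open>Vanishing pair counts and separation from \<open>\<gamma>\<close>\<close>

lemma pair_count_liminf_eq_0:
  assumes "\<forall>\<^sub>F N in sequentially. \<forall>m\<in>{1..N}. \<forall>n\<in>{1..N}.
      s / real N < dist_int (x m - x n - \<gamma>)"
  shows "pair_count_liminf x \<gamma> s = 0"
proof -
  let ?c = "\<lambda>N. ereal (real (card {(m, n). m \<in> {1..N} \<and> n \<in> {1..N} \<and> m \<noteq> n \<and>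
        dist_int (x m - x n - \<gamma>) \<le> s / real N}) / real N)"
  have "\<forall>\<^sub>F N in sequentially. ?c N = 0"
    using assms
  proof eventually_elim
    case (elim N)
    then have "{(m, n). m \<in> {1..N} \<and> n \<in> {1..N} \<and> m \<noteq> n \<and>
        dist_int (x m - x n - \<gamma>) \<le> s / real N} = {}"
      by (auto simp: not_le)
    then show ?case by (simp only: card.empty) simp
  qed
  then have "liminf ?c = liminf (\<lambda>_. 0)" by (rule Liminf_eq)
  then show ?thesis by (simp add: pair_count_liminf_def Liminf_const)
qed

text \<open>Scaling by \<open>r ^ k\<close> turns \<open>u - v - i\<close> into an integer for every
  integer \<open>i\<close>, so its distance from \<open>r ^ k * \<gamma>\<close> is at least
  \<open>dist_int (r ^ k * \<gamma>)\<close>.\<close>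

lemma dist_int_diff_lattice_ge:
  fixes r :: nat
  assumes "r > 0"
    and "real r ^ k * u \<in> \<int>" and "real r ^ k * v \<in> \<int>"
  shows "dist_int (real r ^ k * \<gamma>) / real r ^ k \<le> dist_int (u - v - \<gamma>)"
proof -
  obtain i :: int where i: "dist_int (u - v - \<gamma>) = \<bar>u - v - \<gamma> - of_int i\<bar>"
    using dist_int_attained by blast
  have "real r ^ k * u - real r ^ k * v - real r ^ k * of_int i \<in> \<int>"
    using assms by auto
  then obtain j where j: "of_int j = real r ^ k * u - real r ^ k * v - real r ^ k * of_int i"
    by (metis Ints_cases)
  have "dist_int (real r ^ k * \<gamma>) \<le> \<bar>real r ^ k * \<gamma> - of_int j\<bar>" by (rule dist_int_le)
  also have "real r ^ k * \<gamma> - of_int j = - (real r ^ k * (u - v - \<gamma> - of_int i))"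
    unfolding j by (simp add: algebra_simps)
  finally have "dist_int (real r ^ k * \<gamma>) \<le> real r ^ k * dist_int (u - v - \<gamma>)"
    by (simp add: i abs_mult)
  then show ?thesis using assms(1) by (simp add: pos_divide_le_eq mult.commute)
qed

section \<open>The rounded sequence\<close>

theorem theorem3:
  fixes \<gamma> :: real
  assumes "0 < \<gamma>" and "\<gamma> < 1"
  shows "\<exists>(x :: nat \<Rightarrow> real) (G :: real \<Rightarrow> real) (g :: real \<Rightarrow> real).
    (\<forall>n\<ge>1. x n \<in> {0..1}) \<and>
    asymptotic_distribution x G \<and>
    abs_cont_on {0..1} G \<and>
    ae_derivative G g \<and>
    Limsup at_top (\<lambda>s::real. pair_count_liminf x \<gamma> s / ereal (2 * s))
      < ereal (LINT t:{0..1}|lebesgue. g t * periodic_ext g (t + \<gamma>))"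
proof -
  have "\<gamma> \<notin> \<int>" using assms by (auto elim!: Ints_cases)
  then obtain r :: nat where r: "r \<ge> 2" and avoid: "\<And>k. real r ^ k * \<gamma> \<notin> \<int>"
    using base_avoiding_integers by blast
  define d where "d k = dist_int (real r ^ k * \<gamma>) / real r ^ k" for k
  have "d k > 0" for k using r dist_int_pos[OF avoid[of k]] by (simp add: d_def)
  then obtain \<kappa> :: "nat \<Rightarrow> nat" where \<kappa>: "mono \<kappa>" "filterlim \<kappa> at_top sequentially"
    "\<And>n. real (\<kappa> n) \<le> real n * d (\<kappa> n)"
    using slow_unbounded_exponent by blast
  define x where "x n = of_int \<lfloor>real r ^ \<kappa> n * sqrt_blocks n\<rfloor> / real r ^ \<kappa> n" for n
  have x0: "0 \<le> x n" for n using sqrt_blocks_bounds(1)[of n] by (simp add: x_def)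
  have xy: "x n \<le> sqrt_blocks n" for n
    using r by (simp add: x_def pos_divide_le_eq mult.commute)
  have close: "sqrt_blocks n - x n \<le> (1 / real r) ^ \<kappa> n" for n
  proof -
    have "real r ^ \<kappa> n * sqrt_blocks n \<le> of_int \<lfloor>real r ^ \<kappa> n * sqrt_blocks n\<rfloor> + 1" by linarith
    then have "sqrt_blocks n \<le> (of_int \<lfloor>real r ^ \<kappa> n * sqrt_blocks n\<rfloor> + 1) / real r ^ \<kappa> n"
      using r by (simp add: pos_le_divide_eq mult.commute)
    then show ?thesis by (simp add: x_def add_divide_distrib power_one_over)
  qed
  have lattice: "real r ^ \<kappa> N * x n \<in> \<int>" if "n \<le> N" for n N
  proof -
    have "\<kappa> n \<le> \<kappa> N" using \<kappa>(1) that by (auto dest: monoD)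
    \<comment> \<open>Monotonicity of \<open>\<kappa>\<close> nests the lattices: the finest one,
      for index \<open>N\<close>, contains all earlier terms.\<close>
    then have "real r ^ \<kappa> N = real r ^ (\<kappa> N - \<kappa> n) * real r ^ \<kappa> n"
      by (simp flip: power_add)
    then have "real r ^ \<kappa> N * x n = real r ^ (\<kappa> N - \<kappa> n) * of_int \<lfloor>real r ^ \<kappa> n * sqrt_blocks n\<rfloor>"
      using r by (simp add: x_def)
    then show ?thesis by simp
  qed
  have "(\<lambda>k. (1 / real r) ^ k) \<longlonglongrightarrow> 0" using r by (intro LIMSEQ_power_zero) auto
  then have "(\<lambda>n. (1 / real r) ^ \<kappa> n) \<longlonglongrightarrow> 0" using \<kappa>(2) by (rule filterlim_compose)
  then have "(\<lambda>n. sqrt_blocks n - x n) \<longlonglongrightarrow> 0"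
    by (rule Lim_null_comparison[rotated]) (use xy close in auto)
  then have distr: "asymptotic_distribution x (\<lambda>t. t)"
    using asymptotic_distribution_perturb sqrt_blocks_equidistributed x0 xy by blast
  have zero: "pair_count_liminf x \<gamma> s = 0" for s
  proof (rule pair_count_liminf_eq_0)
    \<comment> \<open>The extra 1 gives \<open>s < \<kappa> N \<le> N * d (\<kappa> N)\<close> with
      strict inequality.\<close>
    have "\<forall>\<^sub>F N in sequentially. nat \<lceil>s\<rceil> + 1 \<le> \<kappa> N"
      using \<kappa>(2) by (simp only: filterlim_at_top)
    then show "\<forall>\<^sub>F N in sequentially. \<forall>m\<in>{1..N}. \<forall>n\<in>{1..N}. s / real N < dist_int (x m - x n - \<gamma>)"
      using eventually_gt_at_top[of 0]
    proof eventually_elim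
      case (elim N)
      then have "s < real N * d (\<kappa> N)" using \<kappa>(3)[of N] by linarith
      then have "s / real N < d (\<kappa> N)" using elim by (simp add: pos_divide_less_eq mult.commute)
      moreover have "d (\<kappa> N) \<le> dist_int (x m - x n - \<gamma>)" if "m \<le> N" "n \<le> N" for m n
        unfolding d_def using r that by (intro dist_int_diff_lattice_ge lattice) auto
      ultimately show ?case by (meson atLeastAtMost_iff less_le_trans)
    qed
  qed
  have "\<forall>n\<ge>1. x n \<in> {0..1}"
    using x0 xy sqrt_blocks_bounds(2)
    by (meson atLeastAtMost_iff less_imp_le order_trans)
  \<comment> \<open>The identity preserves lengths, so \<open>\<delta> = \<epsilon>\<close>
    works.\<close>
  moreover have "abs_cont_on {0..1} (\<lambda>t. t)"
    unfolding abs_cont_on_def by auto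
  moreover have "ae_derivative (\<lambda>t. t) (\<lambda>_. 1)"
    unfolding ae_derivative_def by (intro AE_I2 impI) (rule DERIV_ident)
  \<comment> \<open>The left side is 0, and the right side is the length 1 of the unit
    interval.\<close>
  moreover have "Limsup at_top (\<lambda>s::real. pair_count_liminf x \<gamma> s / ereal (2 * s))
      < ereal (LINT t:{0..1}|lebesgue. 1 * periodic_ext (\<lambda>_. 1) (t + \<gamma>))"
    by (simp add: zero Limsup_const periodic_ext_def set_integral_const)
  ultimately show ?thesis using distr by blast
qed

end
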